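(* Let $P$ and $Q$ be finite posets, let $f_\diamond : P \leftrightarrows Q : f^\diamond$ be a Galois connection, let $\mathcal{M}$ be a commutative monoid, and let $m : P \to \mathcal{M}$ be any function. Assume that $m' : P \to \mathcal{M}$ is a monoidal Möbius inverse of $m$. Then the pushforward $(f_\diamond)_\sharp(m') : Q \to \mathcal{M}$ is a monoidal Möbius inverse of the pullback $(f^\diamond)^\sharp m : Q \to \mathcal{M}$.
   Context: A Galois connection $f_\diamond : P \leftrightarrows Q : f^\diamond$ between posets is a pair of order-preserving maps $f_\diamond : P\to Q$ (left adjoint) and $f^\diamond : Q \to P$ (right adjoint) such that $f_\diamond(p)\le q \iff p \le f^\diamond(q)$ for all $p\in P$, $q\in Q$. For a finite poset $P$, a commutative monoid $\mathcal{M}$ (written additively) and a function $m : P\to\mathcal{M}$, a function $m' : P \to \mathcal{M}$ is a monoidal Möbius inverse of $m$ if $\sum_{p'\le p} m'(p') = m(p)$ for all $p\in P$. Pushforward: for $g : P \to \mathcal{M}$ and an order-preserving map $h : P \to Q$, $(h_\sharp g)(q) := \sum_{p\in h^{-1}(q)} g(p)$ (the empty sum is $0$). Pullback: for $g : P \to \mathcal{M}$ and an order-preserving map $h : Q \to P$, $(h^\sharp g)(q) := g(h(q))$. *)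

theory Defs
  imports "HOL-Algebra.Galois_Connection" "HOL-Algebra.Ring"
begin

text \<open>
  A poset is a \<^locale>\<open>partial_order\<close> on a carrier set, which may be empty. An additively
  written commutative monoid is an \<^locale>\<open>abelian_monoid\<close>; it is carried by the additive part of
  a ring record, whose multiplicative fields are unconstrained.
\<close>

text \<open>
  \<^const>\<open>finsum\<close> over an infinite set is a default value, so this and the pushforward below
  are meaningful for a finite \<open>P\<close>.
\<close>

definition monoidal_mobius_inverse ::
  "('a, 'c) gorder_scheme \<Rightarrow> ('m, 'r) ring_scheme \<Rightarrow> ('a \<Rightarrow> 'm) \<Rightarrow> ('a \<Rightarrow> 'm) \<Rightarrow> bool"
  where
  "monoidal_mobius_inverse P M m m' \<longleftrightarrow>
     m' \<in> carrier P \<rightarrow> carrier M \<and>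
     (\<forall>p \<in> carrier P. (\<Oplus>\<^bsub>M\<^esub> p' \<in> {p' \<in> carrier P. p' \<sqsubseteq>\<^bsub>P\<^esub> p}. m' p') = m p)"

definition pushforward ::
  "('a, 'c) gorder_scheme \<Rightarrow> ('m, 'r) ring_scheme \<Rightarrow> ('a \<Rightarrow> 'b) \<Rightarrow> ('a \<Rightarrow> 'm) \<Rightarrow> 'b \<Rightarrow> 'm"
  where
  "pushforward P M h g q = (\<Oplus>\<^bsub>M\<^esub> p \<in> {p \<in> carrier P. h p = q}. g p)"

definition pullback :: "('b \<Rightarrow> 'a) \<Rightarrow> ('a \<Rightarrow> 'm) \<Rightarrow> 'b \<Rightarrow> 'm"
  where
  "pullback h g q = g (h q)"

text \<open>
  The library's \<^locale>\<open>galois_connection\<close> does not list monotonicity of the two adjoints among its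
  assumptions, because it follows from the adjunction; requiring it gives the same notion.
\<close>

lemma galois_connection_iff_isotone:
  "galois_connection \<lparr>orderA = P, orderB = Q, lower = f, upper = g\<rparr> \<longleftrightarrow>
     partial_order P \<and> partial_order Q \<and>
     f \<in> carrier P \<rightarrow> carrier Q \<and> g \<in> carrier Q \<rightarrow> carrier P \<and>
     isotone P Q f \<and> isotone Q P g \<and>
     (\<forall>p \<in> carrier P. \<forall>q \<in> carrier Q. f p \<sqsubseteq>\<^bsub>Q\<^esub> q \<longleftrightarrow> p \<sqsubseteq>\<^bsub>P\<^esub> g q)"
  (is "?L \<longleftrightarrow> ?R")
proof
  assume ?L
  then interpret galois_connection "\<lparr>orderA = P, orderB = Q, lower = f, upper = g\<rparr>" .
  show ?R
    using is_order_A is_order_B lower_closure upper_closure lower_iso upper_iso galois_property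
    by simp
next
  assume ?R
  then show ?L
    by (simp add: galois_connection_def galois_connection_axioms_def connection_def)
qed

end

theory Submission
  imports Defs
begin

text \<open>
  The adjunction says that \<open>f_lower p \<sqsubseteq> q\<close> exactly when \<open>p \<sqsubseteq> f_upper q\<close>. So the fibres of
  \<open>f_lower\<close> over the elements below \<open>q\<close> partition the elements below \<open>f_upper q\<close>. Summing the
  pushforward of \<open>m'\<close> over the elements below \<open>q\<close> therefore regroups, fibre by fibre, the sum of
  \<open>m'\<close> over the elements below \<open>f_upper q\<close>, and that sum is \<open>m (f_upper q)\<close> by hypothesis.
  The regrouping (\<open>finsum_fibres\<close>) uses only associativity and commutativity of addition, and
  zero for the empty fibres, so the argument takes place entirely in a commutative monoid.
\<close>

text \<open>
  The fibres of \<open>h\<close> over distinct points are disjoint, and their union over \<open>B\<close> is the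
  preimage of \<open>B\<close>.
\<close>

lemma (in abelian_monoid) finsum_fibres:
  assumes "finite A" and "finite B" and "g \<in> A \<rightarrow> carrier G"
  shows "(\<Oplus>b\<in>B. \<Oplus>a\<in>{a \<in> A. h a = b}. g a) = (\<Oplus>a\<in>{a \<in> A. h a \<in> B}. g a)"
proof -
  have preimage: "{a \<in> A. h a \<in> B} = (\<Union>b\<in>B. {a \<in> A. h a = b})"
    by blast
  show ?thesis
    unfolding preimage
    by (rule add.finprod_UN_disjoint [symmetric])
      (use assms in \<open>auto simp: pairwise_def disjnt_def\<close>)
qed

theorem theorem2:
  fixes P :: "'a gorder" and Q :: "'b gorder"
    and M :: "('m, 'r) ring_scheme"
    and f_lower :: "'a \<Rightarrow> 'b" and f_upper :: "'b \<Rightarrow> 'a"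
    and m m' :: "'a \<Rightarrow> 'm"
  assumes "partial_order P" and "finite (carrier P)"
    and "partial_order Q" and "finite (carrier Q)"
    and "galois_connection \<lparr>orderA = P, orderB = Q, lower = f_lower, upper = f_upper\<rparr>"
    and "abelian_monoid M"
    and "m \<in> carrier P \<rightarrow> carrier M"
    and "monoidal_mobius_inverse P M m m'"
  shows "monoidal_mobius_inverse Q M (pullback f_upper m) (pushforward P M f_lower m')"
proof -
  interpret abelian_monoid M by fact
  have lower: "f_lower p \<in> carrier Q" if "p \<in> carrier P" for p
    using assms(5) that by (auto simp: galois_connection_iff_isotone)
  have upper: "f_upper q \<in> carrier P" if "q \<in> carrier Q" for q
    using assms(5) that by (auto simp: galois_connection_iff_isotone)
  have adjunction: "f_lower p \<sqsubseteq>\<^bsub>Q\<^esub> q \<longleftrightarrow> p \<sqsubseteq>\<^bsub>P\<^esub> f_upper q"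
    if "p \<in> carrier P" "q \<in> carrier Q" for p q
    using assms(5) that by (simp add: galois_connection_iff_isotone)
  have m'_closed: "m' \<in> carrier P \<rightarrow> carrier M"
    using assms(8) by (simp add: monoidal_mobius_inverse_def)
  have inverse: "(\<Oplus>\<^bsub>M\<^esub> p' \<in> {p' \<in> carrier P. p' \<sqsubseteq>\<^bsub>P\<^esub> p}. m' p') = m p"
    if "p \<in> carrier P" for p
    using assms(8) that by (auto simp: monoidal_mobius_inverse_def)
  have "pushforward P M f_lower m' \<in> carrier Q \<rightarrow> carrier M"
    using m'_closed by (auto simp: pushforward_def intro!: finsum_closed)
  moreover have "(\<Oplus>\<^bsub>M\<^esub> q' \<in> {q' \<in> carrier Q. q' \<sqsubseteq>\<^bsub>Q\<^esub> q}. pushforward P M f_lower m' q')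
      = pullback f_upper m q" if q: "q \<in> carrier Q" for q
  proof -
    have "(\<Oplus>\<^bsub>M\<^esub> q' \<in> {q' \<in> carrier Q. q' \<sqsubseteq>\<^bsub>Q\<^esub> q}. pushforward P M f_lower m' q')
        = (\<Oplus>\<^bsub>M\<^esub> p \<in> {p \<in> carrier P. f_lower p \<in> {q' \<in> carrier Q. q' \<sqsubseteq>\<^bsub>Q\<^esub> q}}. m' p)"
      unfolding pushforward_def
      using assms(2,4) m'_closed by (intro finsum_fibres) auto
    also have "{p \<in> carrier P. f_lower p \<in> {q' \<in> carrier Q. q' \<sqsubseteq>\<^bsub>Q\<^esub> q}}
        = {p \<in> carrier P. p \<sqsubseteq>\<^bsub>P\<^esub> f_upper q}"
      using lower adjunction q by auto
    also have "(\<Oplus>\<^bsub>M\<^esub> p \<in> {p \<in> carrier P. p \<sqsubseteq>\<^bsub>P\<^esub> f_upper q}. m' p) = m (f_upper q)"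
      by (rule inverse [OF upper [OF q]])
    finally show ?thesis
      by (simp add: pullback_def)
  qed
  ultimately show ?thesis
    by (simp add: monoidal_mobius_inverse_def)
qed

end
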